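(* Let $c : \mathbf{R}^d \times \mathbf{R}^d \to \mathbf{R}$ satisfy: (i) $c$ is bounded; (ii) there is a Lebesgue negligible closed set $Z \subset \mathbf{R}^d \times \mathbf{R}^d$ such that $c \in C^2\big((\mathbf{R}^d \times \mathbf{R}^d) \setminus Z\big)$; and (iii) $\det\big[D^2_{x^i y^j} c(x,y)\big]_{i,j=1}^d \ne 0$ for all $(x,y) \in (\mathbf{R}^d \times \mathbf{R}^d) \setminus Z$. Fix $0 \le \bar h \in L^1(\mathbf{R}^d \times \mathbf{R}^d)$ and take $0 \le f, g \in L^1(\mathbf{R}^d)$ such that $\Gamma := \Gamma(f,g)^{\bar h} \ne \emptyset$. If $h \in \Gamma$ is optimal, i.e. $c[h] \le c[k]$ for all $k \in \Gamma$, then $h$ is an extreme point of $\Gamma$.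
   Context: For $0 \le f, g \in L^1(\mathbf{R}^d)$ with $\int f = \int g$ and $0 \le \bar h \in L^1(\mathbf{R}^d \times \mathbf{R}^d)$, the set $\Gamma(f,g)^{\bar h}$ consists of all $0 \le h \in L^1(\mathbf{R}^d \times \mathbf{R}^d)$ (functions identified when equal Lebesgue-a.e.) such that $\int_{\mathbf{R}^d} h(x,\tilde y)\,d\tilde y = f(x)$ for Lebesgue-a.e. $x$, $\int_{\mathbf{R}^d} h(\tilde x,y)\,d\tilde x = g(y)$ for Lebesgue-a.e. $y$, and $h \le \bar h$ almost everywhere. The transportation cost of $h$ is $c[h] := \int_{\mathbf{R}^d \times \mathbf{R}^d} c(x,y) h(x,y)\,dx\,dy$. An element $h \in \Gamma$ is an extreme point of the convex set $\Gamma$ if it is not the midpoint of any nondegenerate segment in $\Gamma$, i.e. $h = \frac12(h_+ + h_-)$ with $h_\pm \in \Gamma$ implies $h_+ = h_-$. $D^2_{x^i y^j} c = \partial^2 c / \partial x^i \partial y^j$ denotes the mixed second partial derivatives. *)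

theory Defs
  imports "HOL-Analysis.Analysis"
begin

text \<open>Twice continuously differentiable on an open set, in the Frechet sense.\<close>

definition C2_on :: "'a::euclidean_space set \<Rightarrow> ('a \<Rightarrow> real) \<Rightarrow> bool" where
  "C2_on S F \<longleftrightarrow>
     (\<exists>(F' :: 'a \<Rightarrow> 'a \<Rightarrow>\<^sub>L real) (F'' :: 'a \<Rightarrow> 'a \<Rightarrow>\<^sub>L ('a \<Rightarrow>\<^sub>L real)).
        (\<forall>p\<in>S. (F has_derivative blinfun_apply (F' p)) (at p)) \<and>
        (\<forall>p\<in>S. (F' has_derivative blinfun_apply (F'' p)) (at p)) \<and>
        continuous_on S F'')"

definition mixed_partial ::
  "((real^'n) \<times> (real^'n) \<Rightarrow> real) \<Rightarrow> 'n \<Rightarrow> 'n \<Rightarrow> real^'n \<Rightarrow> real^'n \<Rightarrow> real" where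
  "mixed_partial c i j x y =
     deriv (\<lambda>s. deriv (\<lambda>t. c (x + s *\<^sub>R axis i 1, y + t *\<^sub>R axis j 1)) 0) 0"

definition mixed_hessian ::
  "((real^'n) \<times> (real^'n) \<Rightarrow> real) \<Rightarrow> real^'n \<Rightarrow> real^'n \<Rightarrow> real^'n^'n" where
  "mixed_hessian c x y = (\<chi> i j. mixed_partial c i j x y)"

text \<open>
  Elements of \<open>L\<^sup>1\<close> are represented by Lebesgue integrable functions, and every pointwise
  condition is required almost everywhere, so that membership only depends on the class
  of a function modulo equality almost everywhere.
\<close>

definition nonneg_L1 :: "('a::euclidean_space \<Rightarrow> real) \<Rightarrow> bool" where
  "nonneg_L1 u \<longleftrightarrow> integrable lebesgue u \<and> (AE p in lebesgue. 0 \<le> u p)"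

text \<open>
  By Fubini's theorem almost every section of an integrable \<open>h\<close> is integrable, so the
  value \<open>0\<close> that the Bochner integral gives to non-integrable sections plays no role
  in the marginal conditions.
\<close>

definition capacity_plans ::
  "(real^'n \<Rightarrow> real) \<Rightarrow> (real^'n \<Rightarrow> real) \<Rightarrow> ((real^'n) \<times> (real^'n) \<Rightarrow> real) \<Rightarrow>
   ((real^'n) \<times> (real^'n) \<Rightarrow> real) set" where
  "capacity_plans f g hbar =
     {h. nonneg_L1 h \<and>
         (AE x in lebesgue. (LINT y|lebesgue. h (x, y)) = f x) \<and>
         (AE y in lebesgue. (LINT x|lebesgue. h (x, y)) = g y) \<and>
         (AE p in lebesgue. h p \<le> hbar p)}"

text \<open>
  The cost is integrated against the Lebesgue measure and not its Borel restriction: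
  the values of \<open>c\<close> on a null set may fail to be Borel measurable.
\<close>

definition transport_cost ::
  "((real^'n) \<times> (real^'n) \<Rightarrow> real) \<Rightarrow> ((real^'n) \<times> (real^'n) \<Rightarrow> real) \<Rightarrow> real" where
  "transport_cost c h = (LINT p|lebesgue. c p * h p)"

definition optimal_plan ::
  "((real^'n) \<times> (real^'n) \<Rightarrow> real) \<Rightarrow> ((real^'n) \<times> (real^'n) \<Rightarrow> real) set \<Rightarrow>
   ((real^'n) \<times> (real^'n) \<Rightarrow> real) \<Rightarrow> bool" where
  "optimal_plan c \<Gamma> h \<longleftrightarrow> h \<in> \<Gamma> \<and> (\<forall>k\<in>\<Gamma>. transport_cost c h \<le> transport_cost c k)"

text \<open>
  Extreme points in \<open>L\<^sup>1\<close>, expressed on representatives. The library's \<open>extreme_point_of\<close>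
  would distinguish functions that differ on a null set.
\<close>

definition ae_extreme_point ::
  "('a::euclidean_space \<Rightarrow> real) \<Rightarrow> ('a \<Rightarrow> real) set \<Rightarrow> bool" where
  "ae_extreme_point h \<Gamma> \<longleftrightarrow>
     h \<in> \<Gamma> \<and>
     (\<forall>h1\<in>\<Gamma>. \<forall>h2\<in>\<Gamma>.
        (AE p in lebesgue. h p = 1/2 * (h1 p + h2 p)) \<longrightarrow> (AE p in lebesgue. h1 p = h2 p))"

end

theory Submission
  imports Defs
begin

text \<open>
  If \<open>h\<close> is not extreme, then on a set \<open>S\<close> of positive measure it stays some \<open>e > 0\<close> away
  from both constraints \<open>0\<close> and \<open>hbar\<close> (lemma \<open>non_extreme_imp_slack\<close>), so every bounded
  perturbation that is supported in \<open>S\<close> and has vanishing marginals can be added to \<open>h\<close> in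
  small multiples of either sign. Optimality forces the cost to annihilate all such
  perturbations; the proof exhibits one that it does not annihilate.

  The perturbation moves mass around the corners of small rectangles. For a compact set \<open>F\<close>
  and displacements \<open>a\<close>, \<open>b\<close>, put
  \[ k(x,y) = 1_F(x,y) - 1_F(x-a,y) - 1_F(x,y-b) + 1_F(x-a,y-b). \]
  Translation invariance makes both marginals of \<open>k\<close> vanish, and turns the cost of \<open>k\<close> into the
  integral over \<open>F\<close> of the mixed second difference
  \[ c(x+a,y+b) - c(x+a,y) - c(x,y+b) + c(x,y). \]
  By the mean value theorem, applied once in each variable, this difference is a value of
  \<open>D\<^sup>2c\<close> in the directions \<open>(a,0)\<close> and \<open>(0,b)\<close> (lemma \<open>mixed_difference_mean_value\<close>). Since the
  mixed Hessian is not singular, one of its entries, say the one with indices \<open>i\<close> and \<open>j\<close>, is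
  nonzero at a suitable point of \<open>S\<close>, and by continuity it keeps its sign in a ball
  around that point. With \<open>a\<close> along the \<open>i\<close>-th axis and \<open>b\<close> along the \<open>j\<close>-th, the integrand has
  one sign on \<open>F\<close>, so the cost of \<open>k\<close> is nonzero as soon as \<open>F\<close> has positive measure.

  For \<open>k\<close> to live on \<open>S\<close>, all four corners of the rectangles based in \<open>F\<close> must lie in a compact
  part \<open>K\<close> of \<open>S\<close>. That such an \<open>F\<close> of positive measure exists for all small \<open>a\<close>, \<open>b\<close> is a
  Steinhaus-type property of \<open>K\<close> (lemma \<open>common_translates_non_negligible\<close>).
\<close>

section \<open>Mixed differences and mixed derivatives\<close>

text \<open>
  The mean value theorem for \<open>t \<mapsto> f (p + u + t v) - f (p + t v)\<close> produces a difference
  of first derivatives, and a second application in the direction \<open>u\<close> finishes. Convexity keeps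
  the parallelogram inside \<open>U\<close> once its corners are there.
\<close>

lemma mixed_difference_mean_value:
  fixes f :: "'a::real_normed_vector \<Rightarrow> real"
  assumes "convex U"
    and f: "\<And>z. z \<in> U \<Longrightarrow> (f has_derivative blinfun_apply (F' z)) (at z)"
    and F': "\<And>z. z \<in> U \<Longrightarrow> (F' has_derivative blinfun_apply (F'' z)) (at z)"
    and corners: "p \<in> U" "p + u \<in> U" "p + v \<in> U" "p + u + v \<in> U"
  obtains z where "z \<in> U" "f (p + u + v) - f (p + u) - f (p + v) + f p = F'' z u v"
proof -
  have seg: "q + t *\<^sub>R w \<in> U" if "q \<in> U" "q + w \<in> U" "0 \<le> t" "t \<le> 1" for q w and t :: real
  proof -
    have "q + t *\<^sub>R w = (1 - t) *\<^sub>R q + t *\<^sub>R (q + w)" by (simp add: algebra_simps)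
    then show ?thesis using convexD_alt[OF \<open>convex U\<close> that] by simp
  qed
  have "\<exists>t\<in>{0<..<1}. (f (p + u + 1 *\<^sub>R v) - f (p + 1 *\<^sub>R v)) - (f (p + u + 0 *\<^sub>R v) - f (p + 0 *\<^sub>R v))
     = (\<lambda>s. F' (p + u + t *\<^sub>R v) (s *\<^sub>R v) - F' (p + t *\<^sub>R v) (s *\<^sub>R v)) (1 - 0)"
  proof (rule mvt_simple)
    fix t :: real assume t: "0 \<le> t" "t \<le> 1"
    have line: "((\<lambda>t. q + t *\<^sub>R v) has_derivative (\<lambda>s. s *\<^sub>R v)) (at t within {0..1})" for q
      by (auto intro!: derivative_eq_intros)
    have *: "((\<lambda>t. f (q + t *\<^sub>R v)) has_derivative (\<lambda>s. F' (q + t *\<^sub>R v) (s *\<^sub>R v))) (at t within {0..1})"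
      if "q \<in> U" "q + v \<in> U" for q
      using has_derivative_compose[OF line f[OF seg[OF that t]]] .
    show "((\<lambda>t. f (p + u + t *\<^sub>R v) - f (p + t *\<^sub>R v)) has_derivative
       (\<lambda>s. F' (p + u + t *\<^sub>R v) (s *\<^sub>R v) - F' (p + t *\<^sub>R v) (s *\<^sub>R v))) (at t within {0..1})"
      by (intro has_derivative_diff * corners)
  qed simp
  then obtain t where t: "0 \<le> t" "t \<le> 1" and 1: "f (p + u + v) - f (p + v) - (f (p + u) - f p)
      = F' (p + u + t *\<^sub>R v) v - F' (p + t *\<^sub>R v) v"
    unfolding greaterThanLessThan_iff Bex_def scaleR_one scaleR_zero_left add_0_right diff_zero
    using less_imp_le by blast
  define q where "q = p + t *\<^sub>R v"
  have q: "q \<in> U" "q + u \<in> U"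
    using seg[of p v t] seg[of "p + u" v t] t corners by (auto simp: q_def algebra_simps)
  have "\<exists>s\<in>{0<..<1::real}. F' (q + 1 *\<^sub>R u) v - F' (q + 0 *\<^sub>R u) v
     = (\<lambda>r. F'' (q + s *\<^sub>R u) (r *\<^sub>R u) v) (1 - 0)"
  proof (rule mvt_simple)
    fix s :: real assume s: "0 \<le> s" "s \<le> 1"
    have line: "((\<lambda>s. q + s *\<^sub>R u) has_derivative (\<lambda>r. r *\<^sub>R u)) (at s within {0..1})"
      by (auto intro!: derivative_eq_intros)
    have "((\<lambda>s. F' (q + s *\<^sub>R u)) has_derivative (\<lambda>r. F'' (q + s *\<^sub>R u) (r *\<^sub>R u))) (at s within {0..1})"
      using has_derivative_compose[OF line F'[OF seg[OF q s]]] .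
    from bounded_linear.has_derivative[OF blinfun.bounded_linear_left this]
    show "((\<lambda>s. F' (q + s *\<^sub>R u) v) has_derivative (\<lambda>r. F'' (q + s *\<^sub>R u) (r *\<^sub>R u) v)) (at s within {0..1})" .
  qed simp
  then obtain s where s: "0 \<le> s" "s \<le> 1" and 2: "F' (q + u) v - F' q v = F'' (q + s *\<^sub>R u) u v"
    unfolding greaterThanLessThan_iff Bex_def scaleR_one scaleR_zero_left add_0_right diff_zero
    using less_imp_le by blast
  have "p + u + t *\<^sub>R v = q + u" by (simp add: q_def)
  with 1 2 have "f (p + u + v) - f (p + u) - f (p + v) + f p = F'' (q + s *\<^sub>R u) u v"
    by (simp add: q_def[symmetric])
  then show ?thesis using that seg[OF q s] by blast
qed

text \<open>
  Near \<open>0\<close> the inner derivative is the value of the Frechet derivative, because the point stays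
  in the open set \<open>S\<close>; only this local identity matters for the outer derivative.
\<close>

lemma mixed_partial_eq_second_derivative:
  fixes c :: "(real^'n) \<times> (real^'n) \<Rightarrow> real"
  assumes "open S"
    and c: "\<And>p. p \<in> S \<Longrightarrow> (c has_derivative blinfun_apply (F' p)) (at p)"
    and F': "\<And>p. p \<in> S \<Longrightarrow> (F' has_derivative blinfun_apply (F'' p)) (at p)"
    and "(x, y) \<in> S"
  shows "mixed_partial c i j x y = F'' (x, y) (axis i 1, 0) (0, axis j 1)"
proof -
  let ?u = "(axis i 1, 0) :: (real^'n) \<times> (real^'n)" and ?v = "(0, axis j 1) :: (real^'n) \<times> (real^'n)"
  have inner: "deriv (\<lambda>t. c (x + s *\<^sub>R axis i 1, y + t *\<^sub>R axis j 1)) 0 = F' ((x, y) + s *\<^sub>R ?u) ?v"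
    if "(x, y) + s *\<^sub>R ?u \<in> S" for s
  proof (rule DERIV_imp_deriv)
    have "((\<lambda>t. (x, y) + s *\<^sub>R ?u + t *\<^sub>R ?v) has_derivative (\<lambda>r. r *\<^sub>R ?v)) (at 0)"
      by (auto intro!: derivative_eq_intros)
    moreover have "(c has_derivative blinfun_apply (F' ((x, y) + s *\<^sub>R ?u))) (at ((x, y) + s *\<^sub>R ?u + 0 *\<^sub>R ?v))"
      using c[OF that] by simp
    ultimately have "((\<lambda>t. c ((x, y) + s *\<^sub>R ?u + t *\<^sub>R ?v)) has_derivative
        (\<lambda>r. F' ((x, y) + s *\<^sub>R ?u) (r *\<^sub>R ?v))) (at 0)"
      by (rule has_derivative_compose)
    then have "((\<lambda>t. c ((x, y) + s *\<^sub>R ?u + t *\<^sub>R ?v)) has_field_derivative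
        F' ((x, y) + s *\<^sub>R ?u) ?v) (at 0)"
      by (simp add: has_field_derivative_def blinfun.scaleR_right mult_commute_abs del: scaleR_Pair)
    then show "((\<lambda>t. c (x + s *\<^sub>R axis i 1, y + t *\<^sub>R axis j 1)) has_field_derivative
        F' ((x, y) + s *\<^sub>R ?u) ?v) (at 0)"
      by simp
  qed
  have "((\<lambda>s. (x, y) + s *\<^sub>R ?u) \<longlongrightarrow> (x, y) + 0 *\<^sub>R ?u) (nhds 0)"
    by (intro tendsto_intros) (auto simp: filterlim_ident)
  then have "eventually (\<lambda>s. (x, y) + s *\<^sub>R ?u \<in> S) (nhds 0)"
    using topological_tendstoD \<open>open S\<close> \<open>(x, y) \<in> S\<close> by fastforce
  then have "eventually (\<lambda>s. deriv (\<lambda>t. c (x + s *\<^sub>R axis i 1, y + t *\<^sub>R axis j 1)) 0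
      = F' ((x, y) + s *\<^sub>R ?u) ?v) (nhds 0)"
    by eventually_elim (rule inner)
  then have "mixed_partial c i j x y = deriv (\<lambda>s. F' ((x, y) + s *\<^sub>R ?u) ?v) 0"
    unfolding mixed_partial_def by (rule deriv_cong_ev) simp
  also have "\<dots> = F'' (x, y) ?u ?v"
  proof (rule DERIV_imp_deriv)
    have "((\<lambda>s. (x, y) + s *\<^sub>R ?u) has_derivative (\<lambda>r. r *\<^sub>R ?u)) (at 0)"
      by (auto intro!: derivative_eq_intros)
    moreover have "(F' has_derivative blinfun_apply (F'' (x, y))) (at ((x, y) + 0 *\<^sub>R ?u))"
      using F'[OF \<open>(x, y) \<in> S\<close>] by simp
    ultimately have "((\<lambda>s. F' ((x, y) + s *\<^sub>R ?u)) has_derivative (\<lambda>r. F'' (x, y) (r *\<^sub>R ?u))) (at 0)"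
      by (rule has_derivative_compose)
    from bounded_linear.has_derivative[OF blinfun.bounded_linear_left this]
    show "((\<lambda>s. F' ((x, y) + s *\<^sub>R ?u) ?v) has_field_derivative F'' (x, y) ?u ?v) (at 0)"
      by (simp add: has_field_derivative_def blinfun.scaleR_right blinfun.scaleR_left mult_commute_abs del: scaleR_Pair)
  qed
  finally show ?thesis .
qed

section \<open>Sets of positive measure\<close>

text \<open>
  Enclose \<open>K\<close> in an open set \<open>G\<close> of hardly larger measure. A short translate of \<open>K\<close> still lies in
  \<open>G\<close> and so misses only a small part of \<open>G\<close>; finitely many translates together miss less than
  all of \<open>G\<close>.
\<close>

lemma common_translates_non_negligible:
  fixes K :: "'a::euclidean_space set"
  assumes "compact K" and "\<not> negligible K"
  obtains r where "r > 0"
    "\<forall>V. finite V \<longrightarrow> card V \<le> n \<longrightarrow> V \<subseteq> ball 0 r \<longrightarrow> \<not> negligible {p. \<forall>v\<in>V. p + v \<in> K}"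
proof -
  have K: "K \<in> lmeasurable" using lmeasurable_compact[OF \<open>compact K\<close>] .
  with \<open>\<not> negligible K\<close> have pos: "measure lebesgue K > 0"
    by (simp add: negligible_iff_measure0 zero_less_measure_iff)
  \<comment> \<open>Each of \<open>n\<close> translates may miss a part of measure \<open>e\<close>, and \<open>n * e < measure lebesgue K\<close>.\<close>
  define e where "e = measure lebesgue K / (n + 1)"
  have "e > 0" using pos by (simp add: e_def)
  obtain G where G: "open G" "K \<subseteq> G" "G - K \<in> lmeasurable" "emeasure lebesgue (G - K) < e"
    using sets_lebesgue_outer_open[of K e] K \<open>e > 0\<close> by auto
  have GK: "measure lebesgue (G - K) < e"
    using G \<open>e > 0\<close> by (simp add: emeasure_eq_measure2 ennreal_less_iff)
  have Gm: "G \<in> lmeasurable"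
    using fmeasurable.Un[OF G(3) K] G(2) by (simp add: Un_absorb2)
  have mG: "measure lebesgue G < measure lebesgue K + e"
    using measurable_measure_Diff[OF Gm _ G(2)] K GK by simp
  obtain r where "r > 0" and r: "(\<Union>x\<in>K. ball x r) \<subseteq> G"
    using compact_subset_open_imp_ball_epsilon_subset[OF \<open>compact K\<close> G(1,2)] by metis
  show ?thesis
  proof (rule that[OF \<open>r > 0\<close>], intro allI impI)
    fix V :: "'a set" assume V: "finite V" "card V \<le> n" "V \<subseteq> ball 0 r"
    let ?F = "{p. \<forall>v\<in>V. p + v \<in> K}"
    define K' where "K' v = (+) (- v) ` K" for v
    have K'_iff: "p \<in> K' v \<longleftrightarrow> p + v \<in> K" for p v
      by (force simp: K'_def image_iff algebra_simps)
    have K'm: "K' v \<in> lmeasurable" "measure lebesgue (K' v) = measure lebesgue K" for v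
      unfolding K'_def using measurable_translation[OF K] measure_translation by blast+
    have K'G: "K' v \<subseteq> G" if "v \<in> V" for v
    proof
      fix p assume "p \<in> K' v"
      moreover have "p \<in> ball (p + v) r" using that V(3) by (auto simp: dist_norm)
      ultimately show "p \<in> G" using r unfolding K'_iff by blast
    qed
    have miss: "measure lebesgue (G - K' v) \<le> e" if "v \<in> V" for v
      using measurable_measure_Diff[OF Gm _ K'G[OF that]] K'm[of v] mG by simp
    have UN: "(\<Union>v\<in>V. G - K' v) \<in> lmeasurable"
      using V(1) Gm K'm by (intro fmeasurable.finite_UN) auto
    have "measure lebesgue (\<Union>v\<in>V. G - K' v) \<le> (\<Sum>v\<in>V. measure lebesgue (G - K' v))"
      using V(1) Gm K'm by (intro measure_UNION_le) (auto intro: fmeasurableD)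
    also have "\<dots> \<le> card V * e" using sum_mono[OF miss] by simp
    also have "\<dots> \<le> n * e" using V(2) \<open>e > 0\<close> by (intro mult_right_mono) auto
    also have "\<dots> < (n + 1) * e" using \<open>e > 0\<close> by simp
    also have "\<dots> = measure lebesgue K" by (simp add: e_def)
    also have "\<dots> \<le> measure lebesgue G"
      using measure_mono_fmeasurable[OF G(2) _ Gm] K by auto
    finally have less: "measure lebesgue (\<Union>v\<in>V. G - K' v) < measure lebesgue G" .
    show "\<not> negligible ?F"
    proof
      assume "negligible ?F"
      moreover have sub: "G \<subseteq> (\<Union>v\<in>V. G - K' v) \<union> ?F" by (auto simp: K'_iff)
      ultimately have "measure lebesgue G \<le> measure lebesgue ((\<Union>v\<in>V. G - K' v) \<union> ?F)"
        using UN Gm by (intro measure_mono_fmeasurable) (auto simp: negligible_imp_measurable fmeasurable.Un)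
      also have "\<dots> \<le> measure lebesgue (\<Union>v\<in>V. G - K' v) + measure lebesgue ?F"
        using UN \<open>negligible ?F\<close> by (intro measure_Un_le) (auto simp: negligible_imp_sets)
      finally show False using less \<open>negligible ?F\<close> by (simp add: negligible_imp_measure0)
    qed
  qed
qed

lemma non_negligible_contains_compact:
  fixes S :: "'a::euclidean_space set"
  assumes "S \<in> sets lebesgue" "bounded S" "\<not> negligible S"
  obtains K where "compact K" "K \<subseteq> S" "\<not> negligible K"
proof -
  have S: "S \<in> lmeasurable" using assms by (simp add: bounded_set_imp_lmeasurable)
  with assms have pos: "measure lebesgue S > 0"
    by (simp add: negligible_iff_measure0 zero_less_measure_iff)
  obtain K where K: "closed K" "K \<subseteq> S" "S - K \<in> lmeasurable" "emeasure lebesgue (S - K) < measure lebesgue S"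
    using sets_lebesgue_inner_closed[OF assms(1) pos] .
  show ?thesis
  proof (rule that[of K])
    show "compact K" using K assms(2) bounded_subset by (auto simp: compact_eq_bounded_closed)
    show "\<not> negligible K"
    proof
      assume "negligible K"
      then have "measure lebesgue (S - K) = measure lebesgue S"
        using assms(1) by (intro measure_Diff_null_set) (auto simp: negligible_iff_null_sets)
      with K(3,4) show False by (simp add: emeasure_eq_measure2)
    qed
  qed fact
qed

section \<open>Rectangle swaps\<close>

lemma has_bochner_integral_lborel_translation:
  fixes q :: "'a::euclidean_space \<Rightarrow> real"
  assumes "has_bochner_integral lborel q I"
  shows "has_bochner_integral lborel (\<lambda>p. q (p - v)) I"
proof -
  have "has_bochner_integral (distr lborel borel ((+) (- v))) q I"
    using assms by (simp add: lborel_distr_plus)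
  then have "has_bochner_integral lborel (\<lambda>p. q (- v + p)) I"
    using borel_measurable_has_bochner_integral[OF assms]
    by (simp add: has_bochner_integral_iff integrable_distr_eq integral_distr)
  then show ?thesis by simp
qed

lemma has_bochner_integral_lebesgue:
  fixes q :: "'a::euclidean_space \<Rightarrow> real"
  assumes "has_bochner_integral lborel q I"
  shows "has_bochner_integral lebesgue q I"
  using assms borel_measurable_has_bochner_integral[OF assms]
  by (simp add: has_bochner_integral_iff integrable_completion integral_completion)

definition rectangle_swap ::
  "('a::euclidean_space \<times> 'b::euclidean_space) set \<Rightarrow> 'a \<Rightarrow> 'b \<Rightarrow> 'a \<times> 'b \<Rightarrow> real" where
  "rectangle_swap F a b p =
     indicator F p - indicator F (p - (a, 0)) - indicator F (p - (0, b)) + indicator F (p - (a, b))"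

text \<open>
  In a section the four terms pair off: a shift along the section does not change the integral.
  Compactness of \<open>F\<close> makes this true of every section and not only of almost every one.
\<close>

lemma rectangle_swap_section_integrals:
  assumes "compact F"
  shows "has_bochner_integral lebesgue (\<lambda>y. rectangle_swap F a b (x, y)) 0"
    and "has_bochner_integral lebesgue (\<lambda>x. rectangle_swap F a b (x, y)) 0"
proof -
  have ind: "has_bochner_integral lborel (indicator A :: _ \<Rightarrow> real) (measure lborel A)"
    if "compact A" for A :: "'c::euclidean_space set"
    using that by (intro has_bochner_integral_real_indicator) (auto simp: borel_compact emeasure_compact_finite[unfolded infinity_ennreal_def])
  have comp: "compact (snd ` (F \<inter> {x} \<times> UNIV))" "compact (fst ` (F \<inter> UNIV \<times> {y}))" for x y
    using assms by (auto intro!: compact_continuous_image compact_Int_closed closed_Times continuous_intros)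
  have y: "has_bochner_integral lborel (\<lambda>y. indicator F (x, y) :: real) (measure lborel (snd ` (F \<inter> {x} \<times> UNIV)))" for x
    by (rule has_bochner_integral_cong[THEN iffD1, OF refl _ refl ind[OF comp(1)]])
      (force simp: indicator_def image_iff)
  have x: "has_bochner_integral lborel (\<lambda>x. indicator F (x, y) :: real) (measure lborel (fst ` (F \<inter> UNIV \<times> {y})))" for y
    by (rule has_bochner_integral_cong[THEN iffD1, OF refl _ refl ind[OF comp(2)]])
      (force simp: indicator_def image_iff)
  note yt = y has_bochner_integral_lborel_translation[OF y]
  note xt = x has_bochner_integral_lborel_translation[OF x]
  show "has_bochner_integral lebesgue (\<lambda>y. rectangle_swap F a b (x, y)) 0"
    using has_bochner_integral_lebesgue[OF has_bochner_integral_add[OF has_bochner_integral_diff[OF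
      has_bochner_integral_diff[OF yt(1)[of x] yt(1)[of "x - a"]] yt(2)[of x b]] yt(2)[of "x - a" b]]]
    by (simp add: rectangle_swap_def)
  show "has_bochner_integral lebesgue (\<lambda>x. rectangle_swap F a b (x, y)) 0"
    using has_bochner_integral_lebesgue[OF has_bochner_integral_add[OF has_bochner_integral_diff[OF
      has_bochner_integral_diff[OF xt(1)[of y] xt(2)[of a y]] xt(1)[of "y - b"]] xt(2)[of a "y - b"]]]
    by (simp add: rectangle_swap_def)
qed

lemma translated_indicator_integral:
  fixes q :: "'a::euclidean_space \<Rightarrow> real"
  assumes "compact F" "continuous_on K q" "\<And>p. p \<in> F \<Longrightarrow> p + v \<in> K"
  obtains I where "has_bochner_integral lborel (\<lambda>p. indicator F p * q (p + v)) I"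
    "has_bochner_integral lebesgue (\<lambda>p. q p * indicator F (p - v)) I"
proof -
  have "continuous_on F (\<lambda>p. q (p + v))"
    by (rule continuous_on_compose2[OF assms(2)]) (auto intro: continuous_intros assms(3))
  then have "integrable lborel (\<lambda>p. indicator F p *\<^sub>R q (p + v))"
    by (rule borel_integrable_compact[OF \<open>compact F\<close>])
  then have 1: "has_bochner_integral lborel (\<lambda>p. indicator F p * q (p + v)) (LINT p|lborel. indicator F p * q (p + v))"
    by (simp add: has_bochner_integral_iff)
  from has_bochner_integral_lebesgue[OF has_bochner_integral_lborel_translation[OF this, of v]]
  have "has_bochner_integral lebesgue (\<lambda>p. q p * indicator F (p - v)) (LINT p|lborel. indicator F p * q (p + v))"
    by (simp add: mult.commute)
  with 1 show ?thesis by (rule that)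
qed

text \<open>
  Moving the translations from the indicators to \<open>q\<close> turns the swap into a mixed difference.
  The set \<open>K\<close> confines the rectangles to a region where \<open>q\<close> is continuous, since a cost function
  may have singularities elsewhere.
\<close>

lemma rectangle_swap_integral:
  assumes "compact F" "continuous_on K q"
    and corners: "\<And>p. p \<in> F \<Longrightarrow> p \<in> K" "\<And>p. p \<in> F \<Longrightarrow> p + (a, 0) \<in> K"
      "\<And>p. p \<in> F \<Longrightarrow> p + (0, b) \<in> K" "\<And>p. p \<in> F \<Longrightarrow> p + (a, b) \<in> K"
  obtains I where
    "has_bochner_integral lborel (\<lambda>p. indicator F p * (q (p + (a, b)) - q (p + (a, 0)) - q (p + (0, b)) + q p)) I"
    "has_bochner_integral lebesgue (\<lambda>p. q p * rectangle_swap F a b p) I"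
proof -
  obtain I0 where I0: "has_bochner_integral lborel (\<lambda>p. indicator F p * q (p + 0)) I0"
    "has_bochner_integral lebesgue (\<lambda>p. q p * indicator F (p - 0)) I0"
    by (rule translated_indicator_integral[OF assms(1,2), of 0]) (auto intro: corners)
  obtain I1 where I1: "has_bochner_integral lborel (\<lambda>p. indicator F p * q (p + (a, 0))) I1"
    "has_bochner_integral lebesgue (\<lambda>p. q p * indicator F (p - (a, 0))) I1"
    by (rule translated_indicator_integral[OF assms(1,2) corners(2)])
  obtain I2 where I2: "has_bochner_integral lborel (\<lambda>p. indicator F p * q (p + (0, b))) I2"
    "has_bochner_integral lebesgue (\<lambda>p. q p * indicator F (p - (0, b))) I2"
    by (rule translated_indicator_integral[OF assms(1,2) corners(3)])
  obtain I3 where I3: "has_bochner_integral lborel (\<lambda>p. indicator F p * q (p + (a, b))) I3"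
    "has_bochner_integral lebesgue (\<lambda>p. q p * indicator F (p - (a, b))) I3"
    by (rule translated_indicator_integral[OF assms(1,2) corners(4)])
  note combine = has_bochner_integral_add[OF has_bochner_integral_diff[OF has_bochner_integral_diff]]
  show ?thesis
  proof (rule that[of "I3 - I1 - I2 + I0"])
    show "has_bochner_integral lborel
      (\<lambda>p. indicator F p * (q (p + (a, b)) - q (p + (a, 0)) - q (p + (0, b)) + q p)) (I3 - I1 - I2 + I0)"
      using combine[OF I3(1) I1(1) I2(1) I0(1)] by (simp add: algebra_simps)
    have "has_bochner_integral lebesgue (\<lambda>p. q p * rectangle_swap F a b p) (I0 - I1 - I2 + I3)"
      using combine[OF I0(2) I1(2) I2(2) I3(2)] by (simp add: rectangle_swap_def algebra_simps)
    then show "has_bochner_integral lebesgue (\<lambda>p. q p * rectangle_swap F a b p) (I3 - I1 - I2 + I0)"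
      by (simp add: algebra_simps)
  qed
qed

section \<open>Perturbing transport plans\<close>

text \<open>
  The marginals agree on every section: where a section of \<open>h\<close> fails to be integrable, adding
  an integrable function keeps it so, and both integrals have the default value \<open>0\<close>.
\<close>

lemma capacity_plans_add:
  assumes h: "h \<in> capacity_plans f g hbar"
    and k: "integrable lebesgue k"
      "\<And>x. has_bochner_integral lebesgue (\<lambda>y. k (x, y)) 0"
      "\<And>y. has_bochner_integral lebesgue (\<lambda>x. k (x, y)) 0"
    and bounds: "AE p in lebesgue. 0 \<le> h p + k p \<and> h p + k p \<le> hbar p"
  shows "(\<lambda>p. h p + k p) \<in> capacity_plans f g hbar"
proof -
  have add0: "(LINT z|lebesgue. u z + v z) = (LINT z|lebesgue. u z)"
    if "has_bochner_integral lebesgue v 0" for u v :: "'c::euclidean_space \<Rightarrow> real"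
  proof (cases "integrable lebesgue u")
    case True
    then show ?thesis using that by (simp add: has_bochner_integral_iff)
  next
    case False
    then have "\<not> integrable lebesgue (\<lambda>z. u z + v z)"
      using that Bochner_Integration.integrable_diff[of lebesgue "\<lambda>z. u z + v z" v]
      by (auto simp: has_bochner_integral_iff)
    then show ?thesis using False by (simp add: not_integrable_integral_eq)
  qed
  show ?thesis
    using h k(1) bounds by (auto simp: capacity_plans_def nonneg_L1_def add0[OF k(2)] add0[OF k(3)])
qed

text \<open>
  Where \<open>h\<close> attains \<open>0\<close> or \<open>hbar\<close>, any two admissible functions with midpoint \<open>h\<close> must
  both attain the same bound and therefore agree.
\<close>

lemma non_extreme_imp_slack:
  fixes h hbar :: "(real^'n) \<times> (real^'n) \<Rightarrow> real"
  assumes h: "h \<in> capacity_plans f g hbar" and "\<not> ae_extreme_point h (capacity_plans f g hbar)"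
    and "nonneg_L1 hbar"
  obtains e where "e > 0" "{p. e \<le> h p \<and> h p + e \<le> hbar p} \<in> sets lebesgue"
    "\<not> negligible {p. e \<le> h p \<and> h p + e \<le> hbar p}"
proof -
  obtain h1 h2 where h12: "h1 \<in> capacity_plans f g hbar" "h2 \<in> capacity_plans f g hbar"
    and mid: "AE p in lebesgue. h p = 1/2 * (h1 p + h2 p)"
    and neq: "\<not> (AE p in lebesgue. h1 p = h2 p)"
    using assms by (auto simp: ae_extreme_point_def)
  have [measurable]: "h \<in> borel_measurable lebesgue" "hbar \<in> borel_measurable lebesgue"
    using h assms(3) by (auto simp: capacity_plans_def nonneg_L1_def)
  define S where "S n = {p. inverse (real (Suc n)) \<le> h p \<and> h p + inverse (real (Suc n)) \<le> hbar p}" for n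
  have meas: "S n \<in> sets lebesgue" for n
  proof -
    have "{p \<in> space lebesgue. inverse (real (Suc n)) \<le> h p \<and> h p + inverse (real (Suc n)) \<le> hbar p} \<in> sets lebesgue"
      by measurable
    then show ?thesis by (simp add: S_def)
  qed
  have "\<exists>n. \<not> negligible (S n)"
  proof (rule ccontr)
    assume "\<nexists>n. \<not> negligible (S n)"
    then have "AE p in lebesgue. \<forall>n. p \<notin> S n"
      by (auto simp: AE_all_countable negligible_iff_null_sets intro: AE_not_in)
    moreover have "AE p in lebesgue. 0 \<le> h1 p \<and> h1 p \<le> hbar p" "AE p in lebesgue. 0 \<le> h2 p \<and> h2 p \<le> hbar p"
      using h12 by (auto simp: capacity_plans_def nonneg_L1_def)
    ultimately have "AE p in lebesgue. h1 p = h2 p"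
      using mid
    proof eventually_elim
      case (elim p)
      have "\<not> (0 < min (h p) (hbar p - h p))"
      proof
        assume "0 < min (h p) (hbar p - h p)"
        then obtain n where "inverse (real (Suc n)) < min (h p) (hbar p - h p)"
          using reals_Archimedean by blast
        then have "p \<in> S n" by (auto simp: S_def)
        with elim show False by blast
      qed
      with elim show ?case by (auto simp: min_less_iff_conj)
    qed
    with neq show False by blast
  qed
  then obtain n where "\<not> negligible (S n)" ..
  then show ?thesis
    using meas[of n] that[of "inverse (real (Suc n))"] by (simp add: S_def)
qed

text \<open>This makes the transport cost additive in the plan.\<close>

lemma bounded_continuous_ae_times_integrable:
  fixes c h :: "'a::euclidean_space \<Rightarrow> real"
  assumes "bounded (range c)" "closed Z" "negligible Z" "continuous_on (- Z) c" "integrable lebesgue h"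
  shows "integrable lebesgue (\<lambda>p. c p * h p)"
proof -
  have "(\<lambda>p. indicator (- Z) p *\<^sub>R c p) \<in> borel_measurable borel"
    using assms(2,4) by (intro borel_measurable_continuous_on_indicator) auto
  then have "(\<lambda>p. indicator (- Z) p *\<^sub>R c p) \<in> borel_measurable lebesgue"
    by (simp add: measurable_completion)
  moreover have "AE p in lebesgue. indicator (- Z) p *\<^sub>R c p = c p"
    using AE_not_in[of Z lebesgue] assms(3) by (auto simp: negligible_iff_null_sets)
  ultimately have c: "c \<in> borel_measurable lebesgue"
    by (rule borel_measurable_AE)
  obtain B where B: "\<And>p. norm (c p) \<le> B" using assms(1) by (auto simp: bounded_iff)
  have bound: "norm (c p * h p) \<le> norm (B * h p)" for p
    using mult_right_mono[of "\<bar>c p\<bar>" "\<bar>B\<bar>" "\<bar>h p\<bar>"] B[of p] by (simp add: abs_mult)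
  show ?thesis
  proof (rule Bochner_Integration.integrable_bound)
    show "integrable lebesgue (\<lambda>p. B * h p)" using assms(5) by simp
    show "(\<lambda>p. c p * h p) \<in> borel_measurable lebesgue"
      by (rule borel_measurable_times[OF c borel_measurable_integrable[OF assms(5)]])
    show "AE p in lebesgue. norm (c p * h p) \<le> norm (B * h p)" by (rule AE_I2) (rule bound)
  qed
qed

section \<open>Optimal plans are extreme\<close>

theorem theorem3p3:
  fixes c :: "(real^'n) \<times> (real^'n) \<Rightarrow> real"
    and Z :: "((real^'n) \<times> (real^'n)) set"
    and hbar h :: "(real^'n) \<times> (real^'n) \<Rightarrow> real"
    and f g :: "real^'n \<Rightarrow> real"
  assumes "bounded (range c)"
    and "closed Z" and "negligible Z"
    and "C2_on (- Z) c"
    and "\<And>x y. (x, y) \<notin> Z \<Longrightarrow> det (mixed_hessian c x y) \<noteq> 0"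
    and "nonneg_L1 hbar"
    and "nonneg_L1 f" and "nonneg_L1 g"
    and "(LINT x|lebesgue. f x) = (LINT y|lebesgue. g y)"
    and "capacity_plans f g hbar \<noteq> {}"
    and "optimal_plan c (capacity_plans f g hbar) h"
  shows "ae_extreme_point h (capacity_plans f g hbar)"
proof (rule ccontr)
  let ?\<Gamma> = "capacity_plans f g hbar"
  assume "\<not> ae_extreme_point h ?\<Gamma>"
  have h: "h \<in> ?\<Gamma>" and opt: "\<And>k. k \<in> ?\<Gamma> \<Longrightarrow> transport_cost c h \<le> transport_cost c k"
    using assms(11) by (auto simp: optimal_plan_def)
  have Z: "open (- Z)" using assms(2) by auto
  obtain F' F'' where c': "\<And>p. p \<in> - Z \<Longrightarrow> (c has_derivative blinfun_apply (F' p)) (at p)"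
    and c'': "\<And>p. p \<in> - Z \<Longrightarrow> (F' has_derivative blinfun_apply (F'' p)) (at p)"
    and cont: "continuous_on (- Z) F''"
    using assms(4) unfolding C2_on_def by blast
  have contc: "continuous_on (- Z) c"
    by (meson c' continuous_at_imp_continuous_on has_derivative_continuous)
  obtain e where e: "e > 0" and S': "{p. e \<le> h p \<and> h p + e \<le> hbar p} \<in> sets lebesgue"
    "\<not> negligible {p. e \<le> h p \<and> h p + e \<le> hbar p}"
    using non_extreme_imp_slack[OF h \<open>\<not> ae_extreme_point h ?\<Gamma>\<close> assms(6)] .
  define S where "S = {p. e \<le> h p \<and> h p + e \<le> hbar p}"
  note S = S'[folded S_def]
  have "\<not> negligible (S - Z)"
  proof
    assume "negligible (S - Z)"
    then have "negligible ((S - Z) \<union> Z)" using assms(3) by (rule negligible_Un)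
    then show False using S(2) negligible_subset by blast
  qed
  \<comment> \<open>A point near which \<open>S - Z\<close> has positive measure at every scale.\<close>
  then obtain p0 where p0: "p0 \<in> S - Z"
    and dense: "\<And>U. openin (top_of_set (S - Z)) U \<Longrightarrow> p0 \<in> U \<Longrightarrow> \<not> negligible U"
    using locally_negligible_alt by blast
  obtain x0 y0 where xy0: "p0 = (x0, y0)" by fastforce
  have "\<exists>i j. mixed_partial c i j x0 y0 \<noteq> 0"
  proof (rule ccontr)
    assume "\<not> ?thesis"
    then have "mixed_hessian c x0 y0 = mat 0" by (simp add: mixed_hessian_def mat_def vec_eq_iff)
    moreover have "det (mixed_hessian c x0 y0) \<noteq> 0" using p0 xy0 assms(5) by auto
    ultimately show False by (simp only: det_0)
  qed
  then obtain i j where ij: "mixed_partial c i j x0 y0 \<noteq> 0" by blast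
  let ?u = "(axis i 1, 0) :: (real^'n) \<times> (real^'n)" and ?v = "(0, axis j 1) :: (real^'n) \<times> (real^'n)"
  define m where "m = F'' p0 ?u ?v"
  have "m \<noteq> 0"
    using mixed_partial_eq_second_derivative[OF Z c' c'', of x0 y0 i j] ij p0 xy0 by (simp add: m_def)
  have "continuous_on (- Z) (\<lambda>z. m * F'' z ?u ?v)"
    by (intro continuous_intros bounded_linear.continuous_on[OF blinfun.bounded_linear_left] cont)
  then have "open (- Z \<inter> (\<lambda>z. m * F'' z ?u ?v) -` {0<..})"
    using Z by (rule continuous_open_preimage) simp
  moreover have "p0 \<in> - Z \<inter> (\<lambda>z. m * F'' z ?u ?v) -` {0<..}"
    using p0 \<open>m \<noteq> 0\<close> by (auto simp: m_def[symmetric] zero_less_mult_iff)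
  ultimately obtain r where r: "r > 0" "ball p0 r \<subseteq> - Z \<inter> (\<lambda>z. m * F'' z ?u ?v) -` {0<..}"
    by (meson open_contains_ball)
  have "\<not> negligible (S \<inter> ball p0 r)"
  proof -
    have "(S - Z) \<inter> ball p0 r = S \<inter> ball p0 r" using r by auto
    moreover have "openin (top_of_set (S - Z)) ((S - Z) \<inter> ball p0 r)"
      by (simp add: openin_open_Int)
    ultimately show ?thesis using dense p0 r(1) by (metis IntI centre_in_ball DiffD1)
  qed
  moreover have "S \<inter> ball p0 r \<in> sets lebesgue" using S(1) by auto
  ultimately obtain K where K: "compact K" "K \<subseteq> S \<inter> ball p0 r" "\<not> negligible K"
    using non_negligible_contains_compact[of "S \<inter> ball p0 r"] by (metis bounded_Int bounded_ball)
  obtain r' where r': "r' > 0"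
    and trans: "\<forall>V. finite V \<longrightarrow> card V \<le> 4 \<longrightarrow> V \<subseteq> ball 0 r' \<longrightarrow> \<not> negligible {p. \<forall>v\<in>V. p + v \<in> K}"
    using common_translates_non_negligible[OF K(1,3), of 4] .
  \<comment> \<open>The diagonal \<open>(a, b)\<close> has norm at most \<open>2 * t\<close>, which must be less than \<open>r'\<close>.\<close>
  define t where "t = r' / 3"
  have "t > 0" using r' by (simp add: t_def)
  define a b :: "real^'n" where "a = t *\<^sub>R axis i 1" and "b = t *\<^sub>R axis j 1"
  define V where "V = {0, (a, 0), (0, b), (a, b)}"
  define F where "F = {p. \<forall>v\<in>V. p + v \<in> K}"
  have corner: "p \<in> K" "p + (a, 0) \<in> K" "p + (0, b) \<in> K" "p + (a, b) \<in> K"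
    if "p \<in> F" for p
    using that by (auto simp: F_def V_def)
  have "\<not> negligible F"
    unfolding F_def
  proof (rule trans[rule_format])
    show "finite V" "card V \<le> 4"
      using card_length[of "[0, (a, 0), (0, b), (a, b)]"] by (auto simp: V_def)
    have "norm a = t" "norm b = t" using \<open>t > 0\<close> by (auto simp: a_def b_def norm_axis_1)
    then show "V \<subseteq> ball 0 r'"
      using norm_Pair_le[of a b] r' by (auto simp: V_def t_def norm_Pair)
  qed
  have "compact F"
    unfolding compact_eq_bounded_closed
  proof
    show "bounded F" using corner(1) bounded_subset[OF compact_imp_bounded[OF K(1)]] by blast
    have "F = (\<Inter>v\<in>V. (\<lambda>p. p + v) -` K)" by (auto simp: F_def)
    then show "closed F" using compact_imp_closed[OF K(1)]
      by (auto intro!: closed_INT continuous_closed_vimage continuous_intros)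
  qed
  define \<Delta> where "\<Delta> p = c (p + (a, b)) - c (p + (a, 0)) - c (p + (0, b)) + c p" for p
  have sign: "0 < m * \<Delta> p" if "p \<in> F" for p
  proof -
    have ball: "z \<in> - Z" if "z \<in> ball p0 r" for z using that r(2) by blast
    have add: "p + (a, 0) + (0, b) = p + (a, b)" by (simp add: add.assoc)
    have in_ball: "p \<in> ball p0 r" "p + (a, 0) \<in> ball p0 r" "p + (0, b) \<in> ball p0 r" "p + (a, 0) + (0, b) \<in> ball p0 r"
      using corner[OF that] K(2) unfolding add by blast+
    obtain z where z: "z \<in> ball p0 r" "\<Delta> p = F'' z (a, 0) (0, b)"
      unfolding \<Delta>_def add[symmetric]
      using mixed_difference_mean_value[OF convex_ball c'[OF ball] c''[OF ball] in_ball] .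
    have "(a, 0) = t *\<^sub>R ?u" "(0, b) = t *\<^sub>R ?v" by (auto simp: a_def b_def)
    then have "m * \<Delta> p = t * t * (m * F'' z ?u ?v)"
      using z(2) by (simp only: blinfun.scaleR_right blinfun.scaleR_left) simp
    moreover have "0 < m * F'' z ?u ?v" using r(2) z(1) by blast
    ultimately show ?thesis using \<open>t > 0\<close> by (simp only: mult_pos_pos)
  qed
  have contK: "continuous_on K c" by (rule continuous_on_subset[OF contc]) (use K(2) r(2) in blast)
  let ?k = "rectangle_swap F a b"
  obtain D where D: "has_bochner_integral lborel (\<lambda>p. indicator F p * \<Delta> p) D"
    "has_bochner_integral lebesgue (\<lambda>p. c p * ?k p) D"
    using rectangle_swap_integral[OF \<open>compact F\<close> contK corner] unfolding \<Delta>_def .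
  have "D \<noteq> 0"
  proof
    assume "D = 0"
    then have int: "has_bochner_integral lebesgue (\<lambda>p. m * (indicator F p * \<Delta> p)) 0"
      using has_bochner_integral_mult_right[OF has_bochner_integral_lebesgue[OF D(1)], of m] by simp
    have "0 \<le> m * (indicator F p * \<Delta> p)" for p
      using sign[of p] by (auto simp: indicator_def)
    then have "AE p in lebesgue. m * (indicator F p * \<Delta> p) = 0"
      using integral_nonneg_eq_0_iff_AE[of lebesgue "\<lambda>p. m * (indicator F p * \<Delta> p)"] int
      by (auto simp: has_bochner_integral_iff)
    then have "AE p in lebesgue. p \<notin> F"
      by eventually_elim (use sign in \<open>force simp: indicator_def split: if_splits\<close>)
    then show False
      using \<open>\<not> negligible F\<close> by (simp add: negligible_iff_null_sets completion.null_sets_iff_AE)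
  qed
  \<comment> \<open>The swap is bounded by \<open>4\<close>, so the factor \<open>e / 4\<close> fits into the slack; the sign lowers the cost.\<close>
  define s where "s = - (e / 4) * sgn D"
  have "integrable lebesgue ?k"
    using rectangle_swap_integral[OF \<open>compact F\<close> continuous_on_const[of K 1] corner]
    by (auto simp: has_bochner_integral_iff)
  have k0: "?k p = 0" if "p \<notin> K" for p
  proof -
    have "p - v \<notin> F" if "v \<in> V" for v using that \<open>p \<notin> K\<close> by (auto simp: F_def intro!: bexI[of _ v])
    from this[of 0] this[of "(a, 0)"] this[of "(0, b)"] this[of "(a, b)"] show ?thesis
      by (simp add: rectangle_swap_def V_def)
  qed
  have "\<bar>?k p\<bar> \<le> 4" for p by (auto simp: rectangle_swap_def indicator_def)
  then have "\<bar>s\<bar> * \<bar>?k p\<bar> \<le> (e / 4) * 4" for p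
    using e by (intro mult_mono) (auto simp: s_def abs_mult abs_sgn_eq)
  then have small: "\<bar>s * ?k p\<bar> \<le> e" for p by (simp add: abs_mult)
  have "(\<lambda>p. h p + s * ?k p) \<in> ?\<Gamma>"
  proof (rule capacity_plans_add[OF h])
    show "integrable lebesgue (\<lambda>p. s * ?k p)" using \<open>integrable lebesgue ?k\<close> by simp
    show "has_bochner_integral lebesgue (\<lambda>y. s * ?k (x, y)) 0" for x
      using has_bochner_integral_mult_right[OF rectangle_swap_section_integrals(1)[OF \<open>compact F\<close>], of s] by simp
    show "has_bochner_integral lebesgue (\<lambda>x. s * ?k (x, y)) 0" for y
      using has_bochner_integral_mult_right[OF rectangle_swap_section_integrals(2)[OF \<open>compact F\<close>], of s] by simp
    have "AE p in lebesgue. 0 \<le> h p" "AE p in lebesgue. h p \<le> hbar p"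
      using h by (auto simp: capacity_plans_def nonneg_L1_def)
    then show "AE p in lebesgue. 0 \<le> h p + s * ?k p \<and> h p + s * ?k p \<le> hbar p"
    proof eventually_elim
      case (elim p)
      show ?case
      proof (cases "p \<in> K")
        case True
        then have "e \<le> h p" "h p + e \<le> hbar p" using K(2) by (auto simp: S_def)
        with small[of p] show ?thesis by linarith
      qed (use elim k0 in simp)
    qed
  qed
  then have "transport_cost c h \<le> transport_cost c (\<lambda>p. h p + s * ?k p)" by (rule opt)
  also have "\<dots> = transport_cost c h + s * D"
  proof -
    have "integrable lebesgue (\<lambda>p. c p * h p)"
      using h bounded_continuous_ae_times_integrable[OF assms(1-3) contc]
      by (simp add: capacity_plans_def nonneg_L1_def)
    then have "has_bochner_integral lebesgue (\<lambda>p. c p * h p) (transport_cost c h)"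
      by (simp add: transport_cost_def has_bochner_integral_iff)
    from has_bochner_integral_add[OF this has_bochner_integral_mult_right[OF D(2), of s]]
    show ?thesis by (simp add: transport_cost_def has_bochner_integral_iff algebra_simps)
  qed
  finally have "0 \<le> s * D" by simp
  moreover have "s * D = - (e / 4) * \<bar>D\<bar>" by (simp add: s_def abs_sgn)
  ultimately show False using e \<open>D \<noteq> 0\<close> by (auto simp: mult_le_0_iff)
qed

end
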